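(* Suppose $xy = N$ has three lattice points $(x_1, y_1)$, $(x_2, y_2)$ and $(x_3, y_3)$ with $\sqrt{N} < x_1 < x_2 < x_3$. Then, for $N \ge 2^{20}$, $$\max_{i} |x_i - y_i| \ge \left\lfloor 2\sqrt{2}\, N^{1/4} + \frac{1}{2} \right\rfloor .$$ Moreover, the lower bound is best possible. (Note: the lower bound $\max_{i} |x_i - y_i| > 2\sqrt{2}\, N^{1/4} - 2$ is much easier to establish.)
   Context: Here $N$ is a positive integer, a lattice point is a point with integer coordinates, the maximum is over $i = 1, 2, 3$, and $\lfloor x \rfloor$ denotes the largest integer not exceeding $x$. *)

theory Defs
  imports Complex_Main
begin

text \<open>Only the values of \<open>x\<close> and \<open>y\<close> at 1, 2, 3 matter; points are pairs of integers.\<close>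

definition three_lattice_points :: "nat \<Rightarrow> (nat \<Rightarrow> int) \<Rightarrow> (nat \<Rightarrow> int) \<Rightarrow> bool" where
  "three_lattice_points N x y \<longleftrightarrow>
     (\<forall>i\<in>{1, 2, 3}. x i * y i = int N) \<and>
     sqrt (real N) < real_of_int (x 1) \<and> x 1 < x 2 \<and> x 2 < x 3"

definition max_gap :: "(nat \<Rightarrow> int) \<Rightarrow> (nat \<Rightarrow> int) \<Rightarrow> int" where
  "max_gap x y = (MAX i\<in>{1, 2, 3}. \<bar>x i - y i\<bar>)"

text \<open>That \<open>gap_bound\<close> is best possible means that it is attained for infinitely many \<open>N\<close>, so that
  it cannot be improved even for large \<open>N\<close>.\<close>

definition gap_bound :: "nat \<Rightarrow> int" where
  "gap_bound N = \<lfloor>2 * sqrt 2 * real N powr (1 / 4) + 1 / 2\<rfloor>"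

end

theory Submission
  imports Defs
begin

text \<open>For a lattice point with \<open>x > y\<close> put \<open>s = x + y\<close> and \<open>d = x - y\<close>, so that \<open>s\<^sup>2 - d\<^sup>2 = 4N\<close>. The
  integers \<open>s\<close> increase with \<open>x\<close>, hence \<open>s\<^sub>3 \<ge> s\<^sub>1 + 2\<close> and
  \<open>d\<^sub>3\<^sup>2 > s\<^sub>3\<^sup>2 - s\<^sub>1\<^sup>2 > 4 s\<^sub>1 > 8 \<surd>N\<close>, that is, \<open>d\<^sub>3\<close> exceeds \<open>2 \<surd>2 N\<^bsup>1/4\<^esup>\<close>; both lower bounds
  follow by rounding. For sharpness let the three sums be consecutive and \<open>d\<^sub>1 = 1\<close>; this forces
  \<open>N = m\<^sup>4 - m\<^sup>2\<close> and the Pell equation \<open>d\<^sub>3\<^sup>2 = 8m\<^sup>2 + 1\<close>, and \<open>d\<^sub>3\<close> is then within \<open>1/2\<close> of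
  \<open>2 \<surd>2 N\<^bsup>1/4\<^esup>\<close>.\<close>

text \<open>Fourth powers clear all radicals, so that comparing a nonnegative number with the bound
  becomes a polynomial inequality against \<open>64 * N\<close>.\<close>

lemma theta_pow4: "(2 * sqrt 2 * real N powr (1 / 4)) ^ 4 = 64 * real N"
proof (cases "N = 0")
  case False
  then have "(real N powr (1 / 4)) ^ 4 = real N"
    by (simp add: powr_powr flip: powr_realpow)
  moreover have "sqrt 2 ^ 4 = 4"
    using power_mult[of "sqrt 2" 2 2] by simp
  ultimately show ?thesis
    by (simp add: power_mult_distrib)
qed simp

text \<open>For a fixed product, the closer the two factors are, the smaller their sum; here
  \<open>a\<close> lies strictly between \<open>d\<close> and \<open>c\<close>.\<close>

lemma sum_strict_mono_on_hyperbola: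
  fixes a b c d :: int
  assumes "a * b = c * d" "a < c" "d < a" "0 < a"
  shows "a + b < c + d"
proof -
  have "a * ((c + d) - (a + b)) = (c - a) * (a - d)"
    using assms(1) by (simp add: algebra_simps)
  moreover have "(c - a) * (a - d) > 0"
    using assms by simp
  ultimately show ?thesis
    using assms(4) by (metis diff_gt_0_iff_gt zero_less_mult_pos)
qed

lemma max_gap_gt_theta:
  assumes "N > 0" "three_lattice_points N x y"
  shows "2 * sqrt 2 * real N powr (1 / 4) < real_of_int (max_gap x y)"
proof -
  have prod: "x 1 * y 1 = int N" "x 2 * y 2 = int N" "x 3 * y 3 = int N"
    and root: "sqrt (real N) < real_of_int (x 1)" and lt: "x 1 < x 2" "x 2 < x 3"
    using assms(2) by (auto simp: three_lattice_points_def)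
  have "0 < real_of_int (x 1)"
    using root by (meson le_less_trans of_nat_0_le_iff real_sqrt_ge_zero)
  then have x1: "0 < x 1" by simp
  have "real N < (real_of_int (x 1))\<^sup>2"
    using root by (meson not_le real_le_lsqrt sqrt_le_D not_less real_le_rsqrt)
  then have "real_of_int (int N) < real_of_int ((x 1)\<^sup>2)" by simp
  then have N_less: "int N < (x 1)\<^sup>2" by linarith
  have y_less: "y i < x 1" and y_pos: "0 < y i" if "x i * y i = int N" "x 1 \<le> x i" for i
  proof -
    have pos: "0 < x i * y i" using that(1) assms(1) by simp
    then show "0 < y i" using that(2) x1 zero_less_mult_pos by force
    then have "x 1 * y i \<le> x i * y i" using that(2) by simp
    also have "\<dots> < x 1 * x 1" using N_less that(1) by (simp add: power2_eq_square)
    finally show "y i < x 1" using x1 by simp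
  qed
  have y: "y 1 < x 1" "0 < y 1" "y 2 < x 1" "y 3 < x 1" "0 < y 3"
    using y_less y_pos prod lt by auto
  define s d where "s = x 1 + y 1" and "d = x 3 - y 3"
  have "s < x 2 + y 2" "x 2 + y 2 < x 3 + y 3"
    unfolding s_def using prod lt x1 y
    by (auto intro!: sum_strict_mono_on_hyperbola)
  \<comment> \<open>Two strict increases between integers give the 2.\<close>
  then have s3: "s + 2 \<le> x 3 + y 3" by simp
  have s_pos: "0 < s" and d_pos: "0 < d" using x1 y lt by (auto simp: s_def d_def)
  have s_sq: "s\<^sup>2 = 4 * int N + (x 1 - y 1)\<^sup>2"
    using prod(1) by (simp add: s_def power2_eq_square algebra_simps)
  have "(s + 2)\<^sup>2 \<le> (x 3 + y 3)\<^sup>2"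
    using s3 s_pos by (intro power_mono) auto
  also have "\<dots> = d\<^sup>2 + 4 * int N"
    using prod(3) by (simp add: d_def power2_eq_square algebra_simps)
  finally have "(x 1 - y 1)\<^sup>2 + (4 + 4 * s) \<le> d\<^sup>2"
    using s_sq by (simp add: power2_sum)
  then have "4 * s < d\<^sup>2"
    using zero_le_power2[of "x 1 - y 1"] by linarith
  \<comment> \<open>Squaring once more lets \<open>s_sq\<close> replace \<open>s\<close> by its
    lower bound in terms of \<open>N\<close>.\<close>
  then have "(4 * s)\<^sup>2 < (d\<^sup>2)\<^sup>2"
    using s_pos by (intro power_strict_mono) auto
  then have "64 * int N + 16 * (x 1 - y 1)\<^sup>2 < d ^ 4"
    using s_sq by (simp add: power_mult_distrib flip: power_mult)
  then have "64 * int N < d ^ 4"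
    using zero_le_power2[of "x 1 - y 1"] by linarith
  then have "real_of_int (64 * int N) < real_of_int (d ^ 4)"
    by (simp only: of_int_less_iff)
  then have "(2 * sqrt 2 * real N powr (1 / 4)) ^ 4 < real_of_int d ^ 4"
    by (simp add: theta_pow4)
  then have "2 * sqrt 2 * real N powr (1 / 4) < real_of_int d"
    using d_pos by (meson of_int_0_le_iff order_less_imp_le power_less_imp_less_base)
  also have "d \<le> max_gap x y"
    unfolding max_gap_def d_def by (rule order_trans[OF abs_ge_self]) auto
  finally show ?thesis by simp
qed

lemma max_gap_ge_gap_bound:
  assumes "N > 0" "three_lattice_points N x y"
  shows "gap_bound N \<le> max_gap x y"
  unfolding gap_bound_def using max_gap_gt_theta[OF assms] by linarith

text \<open>The Pell equation \<open>(2e + 1)\<^sup>2 = 8m\<^sup>2 + 1\<close>, halved; the step is multiplication by \<open>3 + \<surd>8\<close>.\<close>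

lemma pell_unbounded:
  "\<exists>m e :: int. int n < m \<and> 0 < e \<and> e * (e + 1) = 2 * m\<^sup>2"
proof (induction n)
  case 0
  show ?case by (intro exI[of _ 1]) simp
next
  case (Suc n)
  then obtain m e :: int where "int n < m" "0 < e" "e * (e + 1) = 2 * m\<^sup>2" by blast
  then show ?case
    by (intro exI[of _ "2 * e + 1 + 3 * m"] exI[of _ "3 * e + 1 + 4 * m"])
      (auto simp: power2_eq_square algebra_simps)
qed

lemma gap_bound_attained:
  fixes m e :: int
  assumes m: "5 \<le> m" and e: "0 < e" and pell: "e * (e + 1) = 2 * m\<^sup>2"
  defines "N \<equiv> nat (m\<^sup>2 * (m\<^sup>2 - 1))"
  shows "\<exists>x y. three_lattice_points N x y \<and> max_gap x y = gap_bound N"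
proof -
  \<comment> \<open>The sums are 2m^2 - 1, 2m^2, 2m^2 + 1 and the differences 1, 2m, 2e + 1;
    \<open>pell\<close> makes the third product equal to \<open>N\<close>.\<close>
  define x where "x i = (if i = 1 then m\<^sup>2 else if i = 2 then m\<^sup>2 + m else m\<^sup>2 + 1 + e)" for i :: nat
  define y where "y i = (if i = 1 then m\<^sup>2 - 1 else if i = 2 then m\<^sup>2 - m else m\<^sup>2 - e)" for i :: nat
  have "25 \<le> m\<^sup>2" using power_mono[of 5 m 2] m by simp
  then have "0 < m\<^sup>2 * (m\<^sup>2 - 1)" by (intro mult_pos_pos) linarith+
  then have N: "int N = m\<^sup>2 * (m\<^sup>2 - 1)" and N_pos: "0 < N"
    unfolding N_def by linarith+
  \<comment> \<open>This puts the third point beyond the second and makes its difference the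
    largest.\<close>
  have em: "m \<le> e"
  proof (rule ccontr)
    assume "\<not> m \<le> e"
    then have "e * (e + 1) \<le> m * m" "0 < m * m" using e by (auto intro!: mult_mono)
    then show False using pell by (simp add: power2_eq_square)
  qed
  have "real N = real_of_int (int N)" by simp
  also have "\<dots> < (real_of_int (m\<^sup>2))\<^sup>2"
    unfolding N using m by (simp add: power2_eq_square algebra_simps)
  finally have "sqrt (real N) < real_of_int (m\<^sup>2)"
    by (simp add: real_less_lsqrt)
  moreover have "x i * y i = int N" if "i \<in> {1, 2, 3}" for i
    using that pell by (auto simp: N x_def y_def power2_eq_square algebra_simps)
  ultimately have pts: "three_lattice_points N x y"
    using em m by (auto simp: three_lattice_points_def x_def)
  have gap: "max_gap x y = 2 * e + 1"
    using em m by (simp add: max_gap_def x_def y_def)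
  \<comment> \<open>The aim is 2e + 1/2 as a lower bound for the unrounded value, which then rounds
    to at least 2e + 1. Since e \<ge> m \<ge> 5, the term 2e exceeds 8 + 1/4, which leaves room for
    the -1 in the next bound.\<close>
  have "(2 * real_of_int e + 1 / 2)\<^sup>2 = 4 * real_of_int (e * (e + 1)) - 2 * real_of_int e + 1 / 4"
    by (simp add: power2_eq_square algebra_simps)
  also have "\<dots> \<le> 8 * (real_of_int (m\<^sup>2) - 1)"
    using em m unfolding pell by simp
  finally have "((2 * real_of_int e + 1 / 2)\<^sup>2)\<^sup>2 \<le> (8 * (real_of_int (m\<^sup>2) - 1))\<^sup>2"
    by (intro power_mono) auto
  also have "\<dots> \<le> 64 * real_of_int (int N)"
  proof -
    have "(m\<^sup>2 - 1)\<^sup>2 \<le> int N"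
      using \<open>25 \<le> m\<^sup>2\<close> unfolding N power2_eq_square[of "m\<^sup>2 - 1"] by (intro mult_right_mono) auto
    then have "real_of_int ((m\<^sup>2 - 1)\<^sup>2) \<le> real_of_int (int N)" by (simp only: of_int_le_iff)
    then show ?thesis unfolding power_mult_distrib by simp
  qed
  finally have "(2 * real_of_int e + 1 / 2) ^ 4 \<le> (2 * sqrt 2 * real N powr (1 / 4)) ^ 4"
    by (simp add: theta_pow4 flip: power_mult)
  then have "2 * real_of_int e + 1 / 2 \<le> 2 * sqrt 2 * real N powr (1 / 4)"
    by (rule power_le_imp_le_base[where n = 3, simplified]) simp
  then have "2 * e + 1 \<le> gap_bound N"
    unfolding gap_bound_def by linarith
  then have "max_gap x y = gap_bound N"
    using max_gap_ge_gap_bound[OF N_pos pts] gap by simp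
  then show ?thesis using pts by blast
qed

lemma infinite_gap_bound_attained:
  "infinite {N::nat. N \<ge> K \<and> (\<exists>x y. three_lattice_points N x y \<and> max_gap x y = gap_bound N)}"
  unfolding finite_nat_set_iff_bounded not_ex not_all Ball_def not_imp not_less
proof
  fix B
  \<comment> \<open>Since \<open>N\<close> is at least \<open>m\<close>, a solution with
    \<open>m\<close> beyond \<open>K\<close>, \<open>B\<close> and 5 suffices.\<close>
  obtain m e :: int where m: "int (K + B + 5) < m" and e: "0 < e" "e * (e + 1) = 2 * m\<^sup>2"
    using pell_unbounded by blast
  have "m * 1 \<le> m * m" "1 < m * m" using m by (auto intro: less_1_mult)
  moreover have "m\<^sup>2 * 1 \<le> m\<^sup>2 * (m\<^sup>2 - 1)"
    using \<open>1 < m * m\<close> by (intro mult_left_mono) (auto simp: power2_eq_square)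
  ultimately have "m \<le> m\<^sup>2 * (m\<^sup>2 - 1)" by (simp add: power2_eq_square)
  then have "K \<le> nat (m\<^sup>2 * (m\<^sup>2 - 1))" "B \<le> nat (m\<^sup>2 * (m\<^sup>2 - 1))" using m by linarith+
  moreover have "5 \<le> m" using m by simp
  ultimately show "\<exists>N. N \<in> {N. N \<ge> K \<and>
      (\<exists>x y. three_lattice_points N x y \<and> max_gap x y = gap_bound N)} \<and> B \<le> N"
    using gap_bound_attained e by blast
qed

theorem theorem5:
  shows "(\<forall>(N::nat) x y. N \<ge> 2 ^ 20 \<and> three_lattice_points N x y \<longrightarrow>
            max_gap x y \<ge> gap_bound N) \<and>
         infinite {N::nat. N \<ge> 2 ^ 20 \<and>
            (\<exists>x y. three_lattice_points N x y \<and> max_gap x y = gap_bound N)} \<and>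
         (\<forall>(N::nat) x y. N > 0 \<and> three_lattice_points N x y \<longrightarrow>
            real_of_int (max_gap x y) > 2 * sqrt 2 * real N powr (1 / 4) - 2)"
proof (intro conjI allI impI)
  fix N :: nat and x y :: "nat \<Rightarrow> int"
  assume "N \<ge> 2 ^ 20 \<and> three_lattice_points N x y"
  then show "max_gap x y \<ge> gap_bound N"
    by (intro max_gap_ge_gap_bound) auto
next
  fix N :: nat and x y :: "nat \<Rightarrow> int"
  assume "N > 0 \<and> three_lattice_points N x y"
  then show "real_of_int (max_gap x y) > 2 * sqrt 2 * real N powr (1 / 4) - 2"
    using max_gap_gt_theta[of N x y] by linarith
qed (rule infinite_gap_bound_attained)

end
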